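(* As $n \rightarrow \infty$, $\rho(n)^{-1} \asymp \mu_g(n)$. Consequently, the following implication holds: if the functions $p_n$ converge pointwise, as $n\to\infty$, to a probability measure $p:\mathbb{Z}_{\geq 1} \to [0,\infty)$ and $\mu_g(n) = \Theta(n^{3/10})$, then $\rho(n) = \Theta(n^{-3/10})$.
   Context: Words are finite nonempty strings over the alphabet $\{0,1\}$, with concatenation written $u_1 {}^\frown u_2$. The set $\mathscr{U}$ of Ulam words is defined recursively on length: the one-letter words $0$ and $1$ are Ulam; a word $w \neq 0,1$ is Ulam if and only if there exists exactly one (ordered) pair $(u_1,u_2)$ of Ulam words with $u_1 \neq u_2$ and $w = u_1 {}^\frown u_2$. $\mathscr{U}_n$ denotes the set of Ulam words of length $n$. The density is $\rho(n) := \#\mathscr{U}_n / 2^n$. The map $\pi$ sends a word to the non-negative integer of which it is the binary representation (leading zeros allowed, leftmost letter most significant); it is injective on words of a fixed length. Let $u_1 < u_2 < \ldots < u_{k_n}$ be the ordered elements of $\pi(\mathscr{U}_n)$, so $k_n = \#\mathscr{U}_n$. Define $$p_n : \mathbb{Z}_{\geq 1} \to [0,\infty), \qquad p_n(g) = \frac{\#\{i \mid u_{i+1} - u_i = g\}}{k_n - 1},$$ regarded as a probability measure on $\mathbb{Z}_{\ge 1}$ (the distribution of the gaps), and let $\mu_g(n)$ be the mean of $p_n$, i.e. $\mu_g(n) = \frac{1}{k_n-1}\sum_{i=1}^{k_n-1}(u_{i+1}-u_i)$. The notation $f(n) \asymp h(n)$ (equivalently $f(n) = \Theta(h(n))$)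 means that there are constants $0<c\le C$ with $c\,h(n) \le f(n) \le C\,h(n)$ for all sufficiently large $n$. *)

theory Defs
  imports "HOL-Analysis.Infinite_Sum" "HOL-Library.Landau_Symbols"
begin

text \<open>Words are lists of booleans, \<^const>\<open>False\<close> being the letter 0 and \<^const>\<open>True\<close> the letter 1.\<close>

type_synonym word = "bool list"

text \<open>The nonemptiness guards only serve the recursion on length; since the empty list is not
  Ulam they are redundant, see \<open>ulam_iff\<close>.\<close>

declare conj_cong [fundef_cong]

function ulam :: "word \<Rightarrow> bool" where
  "ulam w \<longleftrightarrow> w = [False] \<or> w = [True] \<or>
     (\<exists>!u. w = fst u @ snd u \<and> fst u \<noteq> [] \<and> snd u \<noteq> [] \<and> fst u \<noteq> snd u \<and>
           ulam (fst u) \<and> ulam (snd u))"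
  by pat_completeness auto
termination by (relation "measure length") auto

declare conj_cong [fundef_cong del]
declare ulam.simps [simp del]

lemma not_ulam_Nil [simp]: "\<not> ulam []"
  by (subst ulam.simps) auto

lemma ulam_letter [simp]: "ulam [b]"
  by (subst ulam.simps) auto

lemma ulam_iff:
  assumes "w \<noteq> [False]" "w \<noteq> [True]"
  shows "ulam w \<longleftrightarrow> (\<exists>!(u1, u2). ulam u1 \<and> ulam u2 \<and> u1 \<noteq> u2 \<and> w = u1 @ u2)"
proof -
  have "(\<lambda>u. w = fst u @ snd u \<and> fst u \<noteq> [] \<and> snd u \<noteq> [] \<and> fst u \<noteq> snd u \<and>
             ulam (fst u) \<and> ulam (snd u)) =
        (\<lambda>(u1, u2). ulam u1 \<and> ulam u2 \<and> u1 \<noteq> u2 \<and> w = u1 @ u2)"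
    by (auto simp: fun_eq_iff)
  then show ?thesis
    using assms by (subst ulam.simps) simp
qed

definition ulam_words :: "nat \<Rightarrow> word set" where
  "ulam_words n = {w. ulam w \<and> length w = n}"

definition density :: "nat \<Rightarrow> real" where
  "density n = real (card (ulam_words n)) / 2 ^ n"

text \<open>The function \<^const>\<open>horner_sum\<close> takes the least significant digit first, hence the reversal.\<close>

definition word_val :: "word \<Rightarrow> nat" where
  "word_val w = horner_sum of_bool 2 (rev w)"

text \<open>The increasing enumeration of the values of the Ulam words of length \<open>n\<close>,
  indexed from 0.\<close>

definition ulam_vals :: "nat \<Rightarrow> nat list" where
  "ulam_vals n = sorted_list_of_set (word_val ` ulam_words n)"

text \<open>The distribution of the gaps and its mean. Only the values at \<open>g \<ge> 1\<close> are meaningful;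
  the mean is that of a measure on the positive integers.\<close>

definition gap_dist :: "nat \<Rightarrow> nat \<Rightarrow> real" where
  "gap_dist n g =
     real (card {i. Suc i < length (ulam_vals n) \<and> ulam_vals n ! Suc i - ulam_vals n ! i = g}) /
     (real (card (ulam_words n)) - 1)"

definition gap_mean :: "nat \<Rightarrow> real" where
  "gap_mean n = (\<Sum>\<^sub>\<infinity>g\<in>{1..}. real g * gap_dist n g)"

definition prob_on_pos :: "(nat \<Rightarrow> real) \<Rightarrow> bool" where
  "prob_on_pos p \<longleftrightarrow> (\<forall>g\<ge>1. p g \<ge> 0) \<and> (p has_sum 1) {1..}"

lemma finite_ulam_words [simp]: "finite (ulam_words n)"
  by (rule finite_subset[OF _ finite_lists_length_eq[of UNIV n]]) (auto simp: ulam_words_def)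

lemma inj_on_word_val: "inj_on word_val {w. length w = n}"
proof (rule inj_onI)
  fix v w :: word
  assume "v \<in> {w. length w = n}" "w \<in> {w. length w = n}" and eq: "word_val v = word_val w"
  then have len: "length (rev v) = length (rev w)" by simp
  have "xs = ys" if "length xs = length ys"
    "horner_sum of_bool (2::nat) xs = horner_sum of_bool 2 ys" for xs ys :: "bool list"
    using that
  proof (induction xs ys rule: list_induct2)
    case (Cons x xs y ys)
    have "of_bool x + 2 * horner_sum of_bool 2 xs = (of_bool y + 2 * horner_sum of_bool 2 ys :: nat)"
      using Cons.prems by simp
    then have "x = y \<and> horner_sum of_bool (2::nat) xs = horner_sum of_bool 2 ys"
      by (cases x; cases y) (simp_all, presburger+)
    then show ?case using Cons.IH by simp
  qed simp
  from this[OF len] eq show "v = w" by (simp add: word_val_def)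
qed

lemma length_ulam_vals: "length (ulam_vals n) = card (ulam_words n)"
proof -
  have "inj_on word_val (ulam_words n)"
    by (rule inj_on_subset[OF inj_on_word_val[of n]]) (auto simp: ulam_words_def)
  then show ?thesis by (simp add: ulam_vals_def card_image)
qed

lemma ulam_vals_less:
  assumes "Suc i < length (ulam_vals n)"
  shows "ulam_vals n ! i < ulam_vals n ! Suc i"
proof -
  have "sorted_wrt (<) (ulam_vals n)"
    by (simp add: ulam_vals_def)
  then show ?thesis using assms sorted_wrt_nth_less by blast
qed

lemma gap_mean_eq:
  "gap_mean n = (\<Sum>i<length (ulam_vals n) - 1. real (ulam_vals n ! Suc i) - real (ulam_vals n ! i)) /
     (real (card (ulam_words n)) - 1)"
proof -
  define d where "d i = ulam_vals n ! Suc i - ulam_vals n ! i" for i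
  define I where "I = {..<length (ulam_vals n) - 1}"
  define K where "K = real (card (ulam_words n)) - 1"
  have I: "Suc i < length (ulam_vals n) \<longleftrightarrow> i \<in> I" for i
    by (auto simp: I_def)
  have dist: "gap_dist n g = real (card {i \<in> I. d i = g}) / K" for g
    by (simp add: gap_dist_def I d_def K_def)
  have fin: "finite I" by (simp add: I_def)
  have pos: "d ` I \<subseteq> {1..}"
    using ulam_vals_less[of _ n] by (fastforce simp: d_def I[symmetric])
  have "gap_mean n = (\<Sum>\<^sub>\<infinity>g\<in>d ` I. real g * gap_dist n g)"
    unfolding gap_mean_def
  proof (rule infsum_cong_neutral)
    fix g assume "g \<in> {1..} - d ` I"
    then have "{i \<in> I. d i = g} = {}" by auto
    then show "real g * gap_dist n g = 0" by (simp only: dist) simp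
  qed (use pos in auto)
  also have "\<dots> = (\<Sum>g\<in>d ` I. real g * gap_dist n g)"
    using fin by simp
  also have "\<dots> = (\<Sum>g\<in>d ` I. \<Sum>i\<in>{i \<in> I. d i = g}. real (d i)) / K"
    unfolding sum_divide_distrib by (intro sum.cong) (auto simp: dist)
  also have "(\<Sum>g\<in>d ` I. \<Sum>i\<in>{i \<in> I. d i = g}. real (d i)) = (\<Sum>i\<in>I. real (d i))"
    using fin by (intro sum.group) auto
  also have "\<dots> = (\<Sum>i\<in>I. real (ulam_vals n ! Suc i) - real (ulam_vals n ! i))"
    using ulam_vals_less[of _ n]
    by (intro sum.cong) (auto simp: d_def I[symmetric] of_nat_diff less_imp_le)
  finally show ?thesis by (simp add: I_def K_def)
qed

end

theory Submission
  imports Defs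
begin

text \<open>The sum of the gaps telescopes to the difference of the extreme elements of
  \<open>\<pi>(\<U>\<^sub>n)\<close>, so it is at most \<open>2\<^sup>n\<close>. Both \<open>0\<dots>01\<close> and \<open>1\<dots>10\<close> are Ulam words: no constant
  word of length at least 2 is Ulam, hence splitting off the first letter is the only
  admissible splitting. Their values are \<open>1\<close> and \<open>2\<^sup>n - 2\<close>, so the sum is at least \<open>2\<^sup>n - 3\<close>.\<close>

text \<open>By strong induction on \<open>k\<close>: an admissible splitting of a longer constant
  word has two shorter constant parts, each Ulam and hence equal to \<open>[b]\<close>, against the
  requirement \<open>u \<noteq> v\<close>.\<close>

lemma ulam_replicateD:
  assumes "ulam (replicate k b)"
  shows "k = 1"
  using assms
proof (induction k rule: less_induct)
  case (less k)
  show ?case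
  proof (rule ccontr)
    assume "k \<noteq> 1"
    then have "replicate k b \<noteq> [False]" "replicate k b \<noteq> [True]"
      by (auto dest: arg_cong[where f = length])
    then obtain u v where uv: "ulam u" "ulam v" "u \<noteq> v" "replicate k b = u @ v"
      using less.prems by (auto simp: ulam_iff)
    have len: "length u + length v = k"
      using arg_cong[OF uv(4), of length] by simp
    have "u = replicate (length u) b" "v = replicate (length v) b"
      using uv(4) by (metis append_eq_conv_conj drop_replicate length_replicate take_replicate)+
    moreover have "length u < k" "length v < k"
      using len uv(1,2) by (auto intro!: Nat.gr0I)
    ultimately have "length u = 1" "length v = 1"
      using less.IH uv(1,2) by metis+
    with \<open>u = _\<close> \<open>v = _\<close> \<open>u \<noteq> v\<close> show False by metis
  qed
qed

lemma ulam_replicate_snoc: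
  assumes "b \<noteq> c"
  shows "ulam (replicate m b @ [c])"
proof (induction m)
  case (Suc m)
  let ?w = "replicate (Suc m) b @ [c]"
  \<comment> \<open>Since \<open>v\<close> is nonempty it absorbs the final \<open>c\<close>. So
    \<open>u\<close> is a constant prefix, and \<open>ulam_replicateD\<close> leaves only
    \<open>u = [b]\<close>.\<close>
  have uniq: "u = [b] \<and> v = replicate m b @ [c]"
    if "ulam u" "ulam v" "?w = u @ v" for u v
  proof -
    obtain v' x where "v = v' @ [x]"
      using \<open>ulam v\<close> by (cases v rule: rev_cases) auto
    moreover from this have "replicate (Suc m) b @ [c] = (u @ v') @ [x]"
      using \<open>?w = u @ v\<close> by simp
    ultimately have v': "v = v' @ [c]" "replicate (Suc m) b = u @ v'"
      unfolding append1_eq_conv by simp_all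
    have u: "u = replicate (length u) b"
      using v'(2) by (metis append_eq_conv_conj take_replicate length_replicate)
    then have "length u = 1"
      using \<open>ulam u\<close> by (metis ulam_replicateD)
    with u have "u = [b]" by (metis One_nat_def replicate_0 replicate_Suc)
    then show ?thesis using v' by simp
  qed
  have "\<exists>!(u, v). ulam u \<and> ulam v \<and> u \<noteq> v \<and> ?w = u @ v"
  proof (rule ex1I[of _ "([b], replicate m b @ [c])"])
    show "case ([b], replicate m b @ [c]) of
      (u, v) \<Rightarrow> ulam u \<and> ulam v \<and> u \<noteq> v \<and> ?w = u @ v"
      \<comment> \<open>The two parts differ because \<open>b \<noteq> c\<close> if
        \<open>m = 0\<close>, and because their lengths differ otherwise.\<close>
      using Suc.IH assms by (cases m) auto
  next
    fix p assume "case p of (u, v) \<Rightarrow> ulam u \<and> ulam v \<and> u \<noteq> v \<and> ?w = u @ v"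
    then show "p = ([b], replicate m b @ [c])"
      using uniq[of "fst p" "snd p"] by (simp add: case_prod_unfold prod_eq_iff)
  qed
  then show ?case
    by (subst ulam_iff) auto
qed simp

lemma word_val_less: "word_val w < 2 ^ length w"
proof -
  have "horner_sum of_bool (2::nat) xs < 2 ^ length xs" for xs :: "bool list"
    by (induction xs) auto
  from this[of "rev w"] show ?thesis by (simp add: word_val_def)
qed

lemma word_val_replicate_False_snoc: "word_val (replicate m False @ [True]) = 1"
proof -
  have "horner_sum of_bool (2::nat) (replicate m False) = 0"
    by (induction m) auto
  then show ?thesis by (simp add: word_val_def)
qed

lemma word_val_replicate_True_snoc: "word_val (replicate m True @ [False]) = 2 ^ Suc m - 2"
proof -
  \<comment> \<open>The successor form keeps truncated subtraction out of the induction.\<close>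
  have "Suc (horner_sum of_bool 2 (replicate m True)) = 2 ^ m"
    by (induction m) auto
  then have "horner_sum of_bool 2 (replicate m True) = (2::nat) ^ m - 1"
    by linarith
  then show ?thesis by (simp add: word_val_def diff_mult_distrib2)
qed

lemma set_ulam_vals: "set (ulam_vals n) = word_val ` ulam_words n"
  by (simp add: ulam_vals_def)

text \<open>Nonemptiness gives \<open>hd\<close> and \<open>last\<close> a meaning. With a single
  Ulam word both sides are \<open>0 / 0\<close>, which is 0.\<close>

lemma gap_mean_telescope:
  assumes "ulam_words n \<noteq> {}"
  shows "gap_mean n = (real (last (ulam_vals n)) - real (hd (ulam_vals n))) /
    (real (card (ulam_words n)) - 1)"
proof -
  have "ulam_vals n \<noteq> []"
    using assms by (auto simp: set_ulam_vals simp flip: set_empty)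
  then show ?thesis
    unfolding gap_mean_eq
    using sum_lessThan_telescope[of "\<lambda>i. real (ulam_vals n ! i)" "length (ulam_vals n) - 1"]
    by (simp add: hd_conv_nth last_conv_nth)
qed

lemma sorted_hd_le_le_last:
  assumes "sorted xs" "x \<in> set xs"
  shows "hd xs \<le> x" "x \<le> last xs"
proof -
  obtain i where i: "i < length xs" and x: "x = xs ! i"
    using assms(2) unfolding in_set_conv_nth by blast
  then have "xs \<noteq> []" by auto
  with i have "hd xs = xs ! 0" "last xs = xs ! (length xs - 1)" "i \<le> length xs - 1"
    by (simp_all add: hd_conv_nth last_conv_nth)
  with i x show "hd xs \<le> x" "x \<le> last xs"
    using sorted_nth_mono[OF assms(1)] by simp_all
qed

text \<open>With \<open>k\<close> words and spread \<open>D\<close>, this compares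
  \<open>2 ^ n / k\<close> with \<open>D / (k - 1)\<close>. Each factor 2 absorbs one discrepancy:
  \<open>D\<close> against \<open>2 ^ n\<close> in the first bound, \<open>k - 1\<close> against
  \<open>k\<close> in the second.\<close>

lemma gap_mean_bounds:
  assumes "n \<ge> 3"
  shows "inverse (density n) \<le> 2 * gap_mean n" "gap_mean n \<le> 2 * inverse (density n)"
proof -
  define k where "k = real (card (ulam_words n))"
  define D where "D = real (last (ulam_vals n)) - real (hd (ulam_vals n))"
  obtain m where m: "n = Suc m" using assms by (cases n) auto
  define v w where "v = replicate m False @ [True]" and "w = replicate m True @ [False]"
  have vw: "v \<in> ulam_words n" "w \<in> ulam_words n" "v \<noteq> w"
    by (auto simp: v_def w_def ulam_words_def m ulam_replicate_snoc)
  have "card {v, w} \<le> card (ulam_words n)"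
    using vw by (intro card_mono) auto
  then have k: "k \<ge> 2" using \<open>v \<noteq> w\<close> by (simp add: k_def)
  have sorted: "sorted (ulam_vals n)" by (simp add: ulam_vals_def)
  have pow: "(2::real) ^ n \<ge> 8"
    using power_increasing[OF assms, of "2::real"] by simp
  have "hd (ulam_vals n) \<le> word_val v" "word_val w \<le> last (ulam_vals n)"
    using vw by (auto intro!: sorted_hd_le_le_last sorted simp: set_ulam_vals)
  moreover have "word_val v = 1" "word_val w = 2 ^ n - 2"
    by (simp_all only: v_def w_def m word_val_replicate_False_snoc word_val_replicate_True_snoc)
  moreover have "real (2 ^ n - 2) = 2 ^ n - 2"
    by (subst of_nat_diff) (auto simp: m)
  ultimately have "D \<ge> 2 ^ n - 3"
    unfolding D_def by (smt (verit) of_nat_1 of_nat_mono)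
  \<comment> \<open>Here \<open>2 * (2 ^ n - 3) \<ge> 2 ^ n\<close> amounts to
    \<open>2 ^ n \<ge> 6\<close>, which \<open>n \<ge> 3\<close> guarantees.\<close>
  with pow have D_lower: "2 ^ n \<le> 2 * D" by linarith
  have "last (ulam_vals n) \<in> word_val ` ulam_words n"
    using vw by (subst set_ulam_vals[symmetric], intro last_in_set)
      (auto simp: set_ulam_vals simp flip: set_empty)
  then have "last (ulam_vals n) < 2 ^ n"
    using word_val_less by (auto simp: ulam_words_def)
  then have "real (last (ulam_vals n)) < real (2 ^ n)"
    by (simp only: of_nat_less_iff)
  then have "real (last (ulam_vals n)) < 2 ^ n"
    unfolding of_nat_power of_nat_numeral .
  then have D_upper: "D \<le> 2 ^ n" unfolding D_def by linarith
  have gap: "gap_mean n = D / (k - 1)" and dens: "inverse (density n) = 2 ^ n / k"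
    using vw gap_mean_telescope[of n] by (auto simp: D_def k_def density_def)
  have "2 ^ n / k \<le> 2 * D / (k - 1)"
    using D_lower pow k by (intro frac_le) auto
  then show "inverse (density n) \<le> 2 * gap_mean n" by (simp add: gap dens)
  \<comment> \<open>From \<open>k \<ge> 2\<close> follows
    \<open>k - 1 \<ge> k / 2 > 0\<close>.\<close>
  have "D / (k - 1) \<le> 2 ^ n / (k / 2)"
    using D_upper k by (intro frac_le) auto
  then show "gap_mean n \<le> 2 * inverse (density n)" by (simp add: gap dens mult.commute)
qed

theorem theorem1p4:
  shows "(\<lambda>n. inverse (density n)) \<in> \<Theta>(gap_mean) \<and>
    (\<forall>p :: nat \<Rightarrow> real.
       prob_on_pos p \<longrightarrow>
       (\<forall>g\<ge>1. (\<lambda>n. gap_dist n g) \<longlonglongrightarrow> p g) \<longrightarrow>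
       gap_mean \<in> \<Theta>(\<lambda>n. real n powr (3/10)) \<longrightarrow>
       density \<in> \<Theta>(\<lambda>n. real n powr (-3/10)))"
proof (intro conjI allI impI)
  have nonneg: "inverse (density n) \<ge> 0" for n
    by (simp add: density_def)
  show theta: "(\<lambda>n. inverse (density n)) \<in> \<Theta>(gap_mean)"
  proof (rule bigthetaI)
    show "(\<lambda>n. inverse (density n)) \<in> O(gap_mean)"
    proof (rule bigoI[of _ 2], rule eventually_sequentiallyI)
      fix n :: nat assume "n \<ge> 3"
      then show "norm (inverse (density n)) \<le> 2 * norm (gap_mean n)"
        \<comment> \<open>The first bound also makes \<open>gap_mean n\<close> nonnegative, so the
          norms disappear.\<close>
        using gap_mean_bounds[of n] nonneg[of n] by simp
    qed
    show "(\<lambda>n. inverse (density n)) \<in> \<Omega>(gap_mean)"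
    proof (rule landau_omega.bigI[of "1/2"], simp, rule eventually_sequentiallyI)
      fix n :: nat assume "n \<ge> 3"
      then show "norm (inverse (density n)) \<ge> 1/2 * norm (gap_mean n)"
        using gap_mean_bounds[of n] nonneg[of n] by simp
    qed
  qed
  assume "gap_mean \<in> \<Theta>(\<lambda>n. real n powr (3/10))"
  with theta have "(\<lambda>n. inverse (density n)) \<in> \<Theta>(\<lambda>n. real n powr (3/10))"
    by (rule landau_theta.trans)
  \<comment> \<open>Inversion preserves \<Theta>, and inverting twice returns
    \<open>density\<close>.\<close>
  then have "(\<lambda>n. inverse (inverse (density n))) \<in> \<Theta>(\<lambda>n. inverse (real n powr (3/10)))"
    by (simp only: bigtheta_inverse)
  then show "density \<in> \<Theta>(\<lambda>n. real n powr (-3/10))"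
    by (simp add: powr_minus)
qed

end
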